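(* (a) The triangle $T_{P'}^{-1}(ABC)$ is the anticevian triangle of $Q$ for $ABC$. (b) Let $X$ be the common point of the lines $AT_P(D_3), BT_P(E_3), CT_P(F_3)$, and let $X'$ be the corresponding point for $P'$, i.e. the common point of the lines $AT_{P'}(D), BT_{P'}(E), CT_{P'}(F)$. Then $T_P(X')=X$ and $T_{P'}(X)=X'$. (c) $X$ is an ordinary point if and only if $X'$ is.
   Context: The plane is the real Euclidean plane extended by the line at infinity $l_\infty$; points not on $l_\infty$ are ordinary, points on it are infinite. Affine maps are extended to act on $l_\infty$. $XY$ denotes the line through $X,Y$, and $\ell\cdot m$ the intersection of lines $\ell,m$. $ABC$ is a nondegenerate triangle with ordinary vertices, its sides being full lines; $G$ is its centroid. The complement map $K$ is the affine map fixing $G$ and sending each ordinary $Y$ to the point $K(Y)$ with $\overrightarrow{GK(Y)}=-\tfrac12\overrightarrow{GY}$; it fixes every infinite point. The anticomplementary triangle is $K^{-1}(ABC)$. $P$ is a point (ordinary or infinite) not lying on the extended sides of $ABC$ or of its anticomplementary triangle. The cevian triangle $DEF$ of $P$ is given by $D=AP\cdot BC$, $E=BP\cdot AC$, $F=CP\cdot AB$. Let $D_3,E_3,F_3$ be the reflections of $D,E,F$ in the midpoints of $BC,AC,AB$ respectively; the lines $AD_3,BE_3,CF_3$ meet in the isotomic conjugate $P'=\iota(P)$ (possibly infinite), so $D_3E_3F_3$ is the cevian triangle of $P'$. The isotomcomplement of $P$ is $Q=K(P')$. $T_P$ and $T_{P'}$ are the affine maps taking $A,B,C$ to $D,E,F$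 and to $D_3,E_3,F_3$ respectively. The anticevian triangle of $Q$ with respect to $ABC$ is the triangle $A'B'C'$ whose cevian triangle for the point $Q$ is $ABC$ (i.e. $A=A'Q\cdot B'C'$, $B=B'Q\cdot A'C'$, $C=C'Q\cdot A'B'$). The lines $AT_P(D_3), BT_P(E_3), CT_P(F_3)$ are known to be concurrent (possibly at an infinite point), and likewise for $P'$. *)

theory Defs
  imports "HOL-Analysis.Analysis"
begin

text \<open>The extended plane: the points of \<open>real^2\<close> together with one infinite point for
  every direction, a direction being a one-dimensional linear subspace.\<close>

typedef direction = "{d :: (real^2) set. subspace d \<and> dim d = 1}"
proof -
  have "dim (span {axis 1 1 :: real^2}) = 1"
    by (simp add: dim_span dim_singleton axis_eq_0_iff)
  then show ?thesis by (auto intro: exI[of _ "span {axis 1 1}"])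
qed

datatype epoint = is_ordinary: Ordinary "real^2" | is_infinite: Infinite direction

definition line_at_infinity :: "epoint set" where
  "line_at_infinity = range Infinite"

definition extended_line :: "(real^2) set \<Rightarrow> epoint set" where
  "extended_line l = Ordinary ` l
     \<union> {Infinite d | d. Rep_direction d = {x - y | x y. x \<in> l \<and> y \<in> l}}"

definition is_line :: "epoint set \<Rightarrow> bool" where
  "is_line m \<longleftrightarrow> m = line_at_infinity \<or> (\<exists>l. affine l \<and> aff_dim l = 1 \<and> m = extended_line l)"

text \<open>The definite descriptions below are meaningful only where the described object exists and is
  unique, e.g. \<open>join X Y\<close> for \<open>X \<noteq> Y\<close> and \<open>meet l m\<close> for distinct lines \<open>l\<close>, \<open>m\<close>.\<close>

definition join :: "epoint \<Rightarrow> epoint \<Rightarrow> epoint set" where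
  "join X Y = (THE l. is_line l \<and> X \<in> l \<and> Y \<in> l)"

definition common_point :: "epoint set set \<Rightarrow> epoint" where
  "common_point L = (THE X. \<forall>l\<in>L. X \<in> l)"

definition meet :: "epoint set \<Rightarrow> epoint set \<Rightarrow> epoint" where
  "meet l m = common_point {l, m}"

text \<open>The action of an affine bijection on infinite points is the action of its linear part
  \<open>\<lambda>v. f v - f 0\<close> on directions.\<close>

primrec extend :: "(real^2 \<Rightarrow> real^2) \<Rightarrow> epoint \<Rightarrow> epoint" where
  "extend f (Ordinary x) = Ordinary (f x)"
| "extend f (Infinite d) = Infinite (Abs_direction ((\<lambda>v. f v - f 0) ` Rep_direction d))"

definition is_affine_map :: "(epoint \<Rightarrow> epoint) \<Rightarrow> bool" where
  "is_affine_map T \<longleftrightarrow> (\<exists>g c. linear g \<and> bij g \<and> T = extend (\<lambda>x. g x + c))"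

type_synonym triangle = "epoint \<times> epoint \<times> epoint"

fun is_triangle :: "triangle \<Rightarrow> bool" where
  "is_triangle (U, V, W) \<longleftrightarrow> \<not> (\<exists>l. is_line l \<and> U \<in> l \<and> V \<in> l \<and> W \<in> l)"

fun on_sides :: "epoint \<Rightarrow> triangle \<Rightarrow> bool" where
  "on_sides Z (U, V, W) \<longleftrightarrow> Z \<in> join V W \<or> Z \<in> join U W \<or> Z \<in> join U V"

fun affine_map_taking :: "triangle \<Rightarrow> triangle \<Rightarrow> epoint \<Rightarrow> epoint" where
  "affine_map_taking (U, V, W) (U', V', W') =
     (THE T. is_affine_map T \<and> T U = U' \<and> T V = V' \<and> T W = W')"

fun map_triangle :: "(epoint \<Rightarrow> epoint) \<Rightarrow> triangle \<Rightarrow> triangle" where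
  "map_triangle T (U, V, W) = (T U, T V, T W)"

fun cevian_triangle :: "triangle \<Rightarrow> epoint \<Rightarrow> triangle" where
  "cevian_triangle (U, V, W) Z =
     (meet (join U Z) (join V W), meet (join V Z) (join U W), meet (join W Z) (join U V))"

text \<open>\<open>is_anticevian_triangle t Z t'\<close>: \<open>t'\<close> is the anticevian triangle of \<open>Z\<close> with respect
  to \<open>t\<close>.  The first two conditions make the cevian triangle of \<open>Z\<close> for \<open>t'\<close> well defined.\<close>

definition is_anticevian_triangle :: "triangle \<Rightarrow> epoint \<Rightarrow> triangle \<Rightarrow> bool" where
  "is_anticevian_triangle t Z t' \<longleftrightarrow>
     is_triangle t' \<and> \<not> on_sides Z t' \<and> cevian_triangle t' Z = t"

text \<open>From here on \<open>A\<close>, \<open>B\<close>, \<open>C\<close> are the ordinary vertices of the reference triangle.\<close>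

definition ordinary_triangle :: "real^2 \<Rightarrow> real^2 \<Rightarrow> real^2 \<Rightarrow> triangle" where
  "ordinary_triangle A B C = (Ordinary A, Ordinary B, Ordinary C)"

definition centroid :: "real^2 \<Rightarrow> real^2 \<Rightarrow> real^2 \<Rightarrow> real^2" where
  "centroid A B C = (1/3) *\<^sub>R (A + B + C)"

definition complement_map :: "real^2 \<Rightarrow> real^2 \<Rightarrow> real^2 \<Rightarrow> epoint \<Rightarrow> epoint" where
  "complement_map A B C =
     extend (\<lambda>Y. centroid A B C + (- (1/2)) *\<^sub>R (Y - centroid A B C))"

definition anticomplementary_triangle :: "real^2 \<Rightarrow> real^2 \<Rightarrow> real^2 \<Rightarrow> triangle" where
  "anticomplementary_triangle A B C =
     map_triangle (inv (complement_map A B C)) (ordinary_triangle A B C)"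

definition point_reflection :: "real^2 \<Rightarrow> epoint \<Rightarrow> epoint" where
  "point_reflection M = extend (\<lambda>x. 2 *\<^sub>R M - x)"

text \<open>The triangle of the points \<open>D\<^sub>3\<close>, \<open>E\<^sub>3\<close>, \<open>F\<^sub>3\<close>.\<close>

definition reflected_cevian_triangle ::
    "real^2 \<Rightarrow> real^2 \<Rightarrow> real^2 \<Rightarrow> epoint \<Rightarrow> triangle" where
  "reflected_cevian_triangle A B C P =
     (let (D, E, F) = cevian_triangle (ordinary_triangle A B C) P in
       (point_reflection (midpoint B C) D,
        point_reflection (midpoint A C) E,
        point_reflection (midpoint A B) F))"

definition isotomic_conjugate :: "real^2 \<Rightarrow> real^2 \<Rightarrow> real^2 \<Rightarrow> epoint \<Rightarrow> epoint" where
  "isotomic_conjugate A B C P =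
     (let (D\<^sub>3, E\<^sub>3, F\<^sub>3) = reflected_cevian_triangle A B C P in
       common_point {join (Ordinary A) D\<^sub>3, join (Ordinary B) E\<^sub>3, join (Ordinary C) F\<^sub>3})"

definition isotomcomplement :: "real^2 \<Rightarrow> real^2 \<Rightarrow> real^2 \<Rightarrow> epoint \<Rightarrow> epoint" where
  "isotomcomplement A B C P = complement_map A B C (isotomic_conjugate A B C P)"

end

theory Submission imports Defs begin

text \<open>
  The proof is a computation in homogeneous barycentric coordinates \<open>x : y : z\<close> with respect to
  \<open>ABC\<close>, extended to infinite points by letting the weight \<open>x + y + z\<close> vanish.  This
  identifies the extended plane with the projective plane of \<open>real^3\<close>: a line is the zero set
  of a linear form (\<open>line_at_infinity_eq\<close>, \<open>is_line_line\<close>, \<open>is_line_cases\<close>), joining and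
  intersecting are cross products (\<open>join_pt\<close>, \<open>meet_line\<close>), and an affine map is linear in the
  coordinates (\<open>affine_map_taking_pt\<close>).

  Let \<open>P = p : q : r\<close>.  Since \<open>P\<close> avoids the sides of \<open>ABC\<close> and of the anticomplementary
  triangle, the numbers \<open>p\<close>, \<open>q\<close>, \<open>r\<close> and the sums \<open>q + r\<close>, \<open>p + r\<close>, \<open>p + q\<close> are nonzero; the
  latter says that the cevian points are ordinary.  Then \<open>D = 0 : q : r\<close> and \<open>D\<^sub>3 = 0 : r : q\<close>,
  hence \<open>P' = 1/p : 1/q : 1/r\<close> and \<open>Q = u : v : w\<close> with \<open>u = p (q + r)\<close>, \<open>v = q (p + r)\<close>,
  \<open>w = r (p + q)\<close>.  In these terms:

  \<^item> The anticevian triangle of \<open>Q\<close> has the vertices \<open>- u : v : w\<close>, \<open>u : - v : w\<close>,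
    \<open>u : v : - w\<close>, for every \<open>Q\<close> off the sides (\<open>is_anticevian_triangle_pt\<close>).  The linear
    map of \<open>T\<^sub>P'\<close> sends \<open>(- u, v, w)\<close> to \<open>p (0, - r, - q) + q (r, 0, p) + r (q, p, 0) = (2 q r, 0, 0)\<close>,
    that is, to \<open>A\<close>; similarly for \<open>B\<close> and \<open>C\<close>.

  \<^item> \<open>X = p\<^sup>2 (q + r) : q\<^sup>2 (p + r) : r\<^sup>2 (p + q)\<close>, and replacing \<open>p\<close>, \<open>q\<close>, \<open>r\<close> by their
    reciprocals gives \<open>X' = q r (q + r) : p r (p + r) : p q (p + q)\<close>.  The linear map of \<open>T\<^sub>P\<close>
    sends the second vector to the first, and that of \<open>T\<^sub>P'\<close> the first to the second.

  \<^item> Both vectors have the same weight, since both expand to the sum of the six monomials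
    \<open>p\<^sup>2 q\<close>, \<open>p\<^sup>2 r\<close>, \<open>q\<^sup>2 p\<close>, \<open>q\<^sup>2 r\<close>, \<open>r\<^sup>2 p\<close>, \<open>r\<^sup>2 q\<close>; so \<open>X\<close> and \<open>X'\<close> are ordinary
    together.
\<close>

unbundle cross3_syntax


section \<open>Linear algebra of \<open>real^3\<close> and directions\<close>

lemma cross_eq_0_proportional:
  fixes u v :: "real^3"
  assumes "u \<times> v = 0" "u \<noteq> 0" "v \<noteq> 0"
  obtains k where "k \<noteq> 0" "u = k *\<^sub>R v"
proof -
  have "collinear {0, v, u}" using assms(1) by (simp add: cross_eq_0 insert_commute)
  then obtain k where "u = k *\<^sub>R v" using assms by (auto simp: collinear_lemma)
  moreover from this have "k \<noteq> 0" using assms(2) by auto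
  ultimately show ?thesis by (rule that[rotated])
qed

lemma orthogonal_both_imp_cross:
  fixes u v w :: "real^3"
  assumes "a \<bullet> u = 0" "a \<bullet> v = 0" shows "a \<times> (u \<times> v) = 0"
  by (simp add: Lagrange assms)

text \<open>
  The linear map of \<open>real^3\<close> whose matrix has the columns \<open>d\<^sub>1\<close>, \<open>d\<^sub>2\<close>, \<open>d\<^sub>3\<close>, which will
  be coordinate vectors of the images of the triangle vertices; the triple product \<open>d\<^sub>1 \<bullet> (d\<^sub>2 \<times> d\<^sub>3)\<close> is its
  determinant.
\<close>

definition frame_map :: "real^3 \<Rightarrow> real^3 \<Rightarrow> real^3 \<Rightarrow> real^3 \<Rightarrow> real^3" where
  "frame_map d\<^sub>1 d\<^sub>2 d\<^sub>3 v = v $ 1 *\<^sub>R d\<^sub>1 + v $ 2 *\<^sub>R d\<^sub>2 + v $ 3 *\<^sub>R d\<^sub>3"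

lemma frame_map_eq_0:
  assumes "d\<^sub>1 \<bullet> (d\<^sub>2 \<times> d\<^sub>3) \<noteq> 0" "frame_map d\<^sub>1 d\<^sub>2 d\<^sub>3 v = 0"
  shows "v = 0"
proof -
  have "frame_map d\<^sub>1 d\<^sub>2 d\<^sub>3 v \<bullet> (d\<^sub>2 \<times> d\<^sub>3) = v $ 1 * (d\<^sub>1 \<bullet> (d\<^sub>2 \<times> d\<^sub>3))"
    "frame_map d\<^sub>1 d\<^sub>2 d\<^sub>3 v \<bullet> (d\<^sub>3 \<times> d\<^sub>1) = v $ 2 * (d\<^sub>1 \<bullet> (d\<^sub>2 \<times> d\<^sub>3))"
    "frame_map d\<^sub>1 d\<^sub>2 d\<^sub>3 v \<bullet> (d\<^sub>1 \<times> d\<^sub>2) = v $ 3 * (d\<^sub>1 \<bullet> (d\<^sub>2 \<times> d\<^sub>3))"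
    by (simp_all add: frame_map_def cross3_def inner_vec_def sum_3 algebra_simps)
  then show ?thesis using assms by (simp add: vec_eq_iff forall_3)
qed

lemma vector_3_eq_0_iff: "(vector [x, y, z] :: real^3) = 0 \<longleftrightarrow> x = 0 \<and> y = 0 \<and> z = 0"
  by (simp add: vec_eq_iff forall_3)

lemma cross_vector_3:
  "(vector [x, y, z] :: real^3) \<times> vector [x', y', z'] =
   vector [y * z' - z * y', z * x' - x * z', x * y' - y * x']"
  by (simp add: cross3_def)

lemma inner_vector_3:
  "(vector [x, y, z] :: real^3) \<bullet> vector [x', y', z'] = x * x' + y * y' + z * z'"
  by (simp add: inner_vec_def sum_3)

lemma frame_map_vector_3:
  "frame_map (vector [a, b, c]) (vector [d, e, f]) (vector [g, h, i]) (vector [x, y, z]) =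
   vector [x * a + y * d + z * g, x * b + y * e + z * h, x * c + y * f + z * i]"
  by (simp add: frame_map_def vec_eq_iff forall_3)

lemmas vector_3_calc = vector_3_eq_0_iff cross_vector_3 inner_vector_3 frame_map_vector_3

lemma Rep_direction_span:
  assumes "x \<noteq> 0" shows "Rep_direction (Abs_direction (span {x})) = span {x}"
  using assms by (intro Abs_direction_inverse) (simp add: dim_singleton)

lemma direction_cases:
  obtains x where "x \<noteq> 0" "d = Abs_direction (span {x})"
proof -
  have "subspace (Rep_direction d)" "dim (Rep_direction d) = 1"
    using Rep_direction[of d] by auto
  moreover obtain Bs where "Bs \<subseteq> Rep_direction d" "independent Bs" "Rep_direction d \<subseteq> span Bs"
      "card Bs = dim (Rep_direction d)"
    using basis_exists by blast
  ultimately have "card Bs = 1" "span Bs = Rep_direction d" "independent Bs"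
    using span_subspace[of Bs "Rep_direction d"] by auto
  then obtain x where "Bs = {x}" "x \<noteq> 0" by (metis card_1_singletonE dependent_single)
  then show ?thesis using that \<open>span Bs = _\<close> by (metis Rep_direction_inverse)
qed


section \<open>Homogeneous barycentric coordinates on the extended plane\<close>

locale reference_triangle =
  fixes A B C :: "real^2"
  assumes noncollinear: "\<not> collinear {A, B, C}"
begin

definition weight :: "real^3 \<Rightarrow> real" where
  "weight v = v $ 1 + v $ 2 + v $ 3"

definition comb :: "real^3 \<Rightarrow> real^2" where
  "comb v = v $ 1 *\<^sub>R A + v $ 2 *\<^sub>R B + v $ 3 *\<^sub>R C"

text \<open>
  The point with homogeneous coordinates \<open>v\<close>: the affine combination of \<open>A\<close>, \<open>B\<close>, \<open>C\<close> with
  the normalized coefficients, or, when normalization is impossible, the direction of the vector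
  \<open>comb v\<close>, which then does not depend on the choice of the origin.
\<close>

definition pt :: "real^3 \<Rightarrow> epoint" where
  "pt v = (if weight v = 0 then Infinite (Abs_direction (span {comb v}))
           else Ordinary (comb v /\<^sub>R weight v))"

definition line :: "real^3 \<Rightarrow> epoint set" where
  "line a = {pt v | v. v \<noteq> 0 \<and> a \<bullet> v = 0}"

lemma weight_simps [simp]:
  "weight (u + v) = weight u + weight v" "weight (u - v) = weight u - weight v"
  "weight (k *\<^sub>R v) = k * weight v" "weight 0 = 0" "weight (vector [x, y, z]) = x + y + z"
  by (simp_all add: weight_def algebra_simps)

lemma comb_simps [simp]:
  "comb (u + v) = comb u + comb v" "comb (u - v) = comb u - comb v"
  "comb (k *\<^sub>R v) = k *\<^sub>R comb v" "comb 0 = 0"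
  "comb (vector [x, y, z]) = x *\<^sub>R A + y *\<^sub>R B + z *\<^sub>R C"
  by (simp_all add: comb_def algebra_simps)

lemma edges_independent: "independent {C - A, B - A}" "B - A \<noteq> C - A"
proof -
  have "\<not> collinear {0, B - A, C - A}"
    using noncollinear by (simp add: collinear_3 insert_commute[of A B])
  then have "B - A \<noteq> 0" and c: "\<And>k. C - A \<noteq> k *\<^sub>R (B - A)"
    by (auto simp: collinear_lemma)
  then show "independent {C - A, B - A}"
    by (auto simp: independent_insert span_singleton)
  show "B - A \<noteq> C - A" using c[of 1] by auto
qed

lemma edge_coordinates:
  obtains b c where "x = b *\<^sub>R (B - A) + c *\<^sub>R (C - A)"
proof -
  have "card {C - A, B - A} = 2" using edges_independent(2) by auto
  then have "dim {C - A, B - A} = DIM(real^2)"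
    using dim_eq_card_independent[OF edges_independent(1)] by simp
  then have "span {C - A, B - A} = UNIV" by (rule dim_eq_full[THEN iffD1])
  then have "x \<in> span (insert (C - A) {B - A})" by simp
  then obtain c where "x - c *\<^sub>R (C - A) \<in> span {B - A}"
    unfolding span_breakdown_eq by metis
  then obtain b where "x - c *\<^sub>R (C - A) = b *\<^sub>R (B - A)"
    unfolding span_singleton by (metis rangeE)
  then have "x = b *\<^sub>R (B - A) + c *\<^sub>R (C - A)"
    by (simp add: diff_eq_eq)
  then show ?thesis by (rule that)
qed

lemma comb_surj: obtains v where "weight v = s" "comb v = x"
proof -
  obtain b c where "x - s *\<^sub>R A = b *\<^sub>R (B - A) + c *\<^sub>R (C - A)"
    by (rule edge_coordinates)
  then have "weight (vector [s - b - c, b, c]) = s" "comb (vector [s - b - c, b, c]) = x"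
    by (simp_all add: algebra_simps)
  then show ?thesis by (rule that)
qed

text \<open>
  Together with \<open>comb_surj\<close>: noncollinearity of \<open>A\<close>, \<open>B\<close>, \<open>C\<close> makes \<open>v \<mapsto> (weight v, comb v)\<close>
  a linear isomorphism from \<open>real^3\<close> onto \<open>real \<times> real^2\<close>.
\<close>

lemma comb_inj: assumes "weight v = 0" "comb v = 0" shows "v = 0"
proof -
  have "v $ 2 *\<^sub>R (B - A) + v $ 3 *\<^sub>R (C - A) = comb v - weight v *\<^sub>R A"
    by (simp add: weight_def comb_def algebra_simps)
  then have "v $ 3 *\<^sub>R (C - A) + v $ 2 *\<^sub>R (B - A) = 0" by (simp add: assms add.commute)
  then have 0: "v $ 3 *\<^sub>R (C - A) = (- (v $ 2)) *\<^sub>R (B - A)"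
    by (simp add: add_eq_0_iff)
  have n: "C - A \<notin> span {B - A}" "B - A \<noteq> 0"
    using edges_independent by (auto simp: independent_insert)
  have "v $ 3 = 0"
  proof (rule ccontr)
    assume "v $ 3 \<noteq> 0"
    then have "C - A = (- (v $ 2) / v $ 3) *\<^sub>R (B - A)"
      using arg_cong[OF 0, of "\<lambda>x. (1 / v $ 3) *\<^sub>R x"] by simp
    then show False using n(1) unfolding span_singleton by blast
  qed
  moreover from this have "v $ 2 = 0" using 0 n(2) by simp
  ultimately show ?thesis using assms(1) by (simp add: vec_eq_iff forall_3 weight_def)
qed

lemma pt_surj: obtains v where "v \<noteq> 0" "X = pt v"
proof (cases X)
  case (Ordinary x)
  obtain v where "weight v = 1" "comb v = x" by (rule comb_surj)
  then have "v \<noteq> 0" "X = pt v" using Ordinary by (auto simp: pt_def)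
  then show ?thesis by (rule that)
next
  case (Infinite d)
  obtain x where x: "x \<noteq> 0" "d = Abs_direction (span {x})" by (rule direction_cases)
  obtain v where "weight v = 0" "comb v = x" by (rule comb_surj)
  then have "v \<noteq> 0" "X = pt v" using Infinite x by (auto simp: pt_def)
  then show ?thesis by (rule that)
qed

lemma pt_scale: assumes "k \<noteq> 0" shows "pt (k *\<^sub>R v) = pt v"
proof -
  have "span {k *\<^sub>R comb v} = span {comb v}"
    using span_image_scale[of "{comb v}" "\<lambda>_. k"] assms by simp
  then show ?thesis using assms by (simp add: pt_def)
qed

lemma proportional_if_pt_eq:
  assumes eq: "pt u = pt v" and nz: "u \<noteq> 0" "v \<noteq> 0"
  obtains k where "k \<noteq> 0" "u = k *\<^sub>R v"
proof (cases "weight v = 0")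
  case True
  then have u0: "weight u = 0" using eq by (auto simp: pt_def split: if_splits)
  have cnz: "comb u \<noteq> 0" "comb v \<noteq> 0" using comb_inj nz True u0 by blast+
  have "span {comb u} = span {comb v}"
  proof -
    have "Abs_direction (span {comb u}) = Abs_direction (span {comb v})"
      using eq True u0 by (simp add: pt_def)
    then show ?thesis using Rep_direction_span cnz by metis
  qed
  then have "comb u \<in> span {comb v}"
    using span_base[of "comb u" "{comb u}"] by simp
  then obtain k where k: "comb u = k *\<^sub>R comb v"
    unfolding span_singleton by (rule rangeE)
  have "u - k *\<^sub>R v = 0" by (rule comb_inj) (use True u0 k in simp_all)
  then have "u = k *\<^sub>R v" by simp
  moreover from this have "k \<noteq> 0" using nz by auto
  ultimately show ?thesis by (rule that[rotated])
next
  case False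
  then have u0: "weight u \<noteq> 0" and c: "comb u /\<^sub>R weight u = comb v /\<^sub>R weight v"
    using eq by (auto simp: pt_def split: if_splits)
  let ?k = "weight u / weight v"
  have "weight u *\<^sub>R (comb u /\<^sub>R weight u) = weight u *\<^sub>R (comb v /\<^sub>R weight v)"
    by (simp only: c)
  then have "comb u = ?k *\<^sub>R comb v" using u0 by (simp add: divide_inverse)
  have "u - ?k *\<^sub>R v = 0"
    by (rule comb_inj) (use False \<open>comb u = _\<close> in simp_all)
  then have "u = ?k *\<^sub>R v" by (rule right_minus_eq[THEN iffD1])
  moreover have "?k \<noteq> 0" using u0 False by simp
  ultimately show ?thesis by (rule that[rotated])
qed

lemma pt_in_line_iff: assumes "v \<noteq> 0" shows "pt v \<in> line a \<longleftrightarrow> a \<bullet> v = 0"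
proof
  assume "pt v \<in> line a"
  then obtain w where "pt v = pt w" "w \<noteq> 0" "a \<bullet> w = 0" by (auto simp: line_def)
  then obtain k where "v = k *\<^sub>R w" using proportional_if_pt_eq assms by metis
  then show "a \<bullet> v = 0" using \<open>a \<bullet> w = 0\<close> by simp
qed (use assms in \<open>auto simp: line_def\<close>)


section \<open>Lines as zero sets of linear forms\<close>

lemma line_scale: "k \<noteq> 0 \<Longrightarrow> line (k *\<^sub>R a) = line a"
  by (simp add: line_def)

lemma line_eq: assumes "a \<times> b = 0" "a \<noteq> 0" "b \<noteq> 0" shows "line a = line b"
  using cross_eq_0_proportional[OF assms] line_scale by metis

lemma line_at_infinity_eq: "line_at_infinity = line (vector [1, 1, 1])"
proof -
  have w: "vector [1, 1, 1] \<bullet> v = weight v" for v :: "real^3"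
    by (simp add: inner_vec_def sum_3 weight_def)
  have "X \<in> line_at_infinity \<longleftrightarrow> X \<in> line (vector [1, 1, 1])" for X
  proof -
    obtain v where v: "v \<noteq> 0" "X = pt v" by (rule pt_surj)
    show ?thesis unfolding v(2) pt_in_line_iff[OF v(1)] w
      by (auto simp: line_at_infinity_def pt_def)
  qed
  then show ?thesis by blast
qed

text \<open>
  For an ordinary point \<open>a\<close> and an infinite point \<open>u\<close> of a line, the points of the line are those
  in the plane of \<open>real^3\<close> spanned by \<open>a\<close> and \<open>u\<close>, whose normal vector is \<open>a \<times> u\<close>.
\<close>

lemma extended_line_eq:
  assumes "weight a = 1" "weight u = 0" "u \<noteq> 0"
  shows "extended_line (range (\<lambda>t. comb a + t *\<^sub>R comb u)) = line (a \<times> u)"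
proof -
  let ?l = "range (\<lambda>t. comb a + t *\<^sub>R comb u)"
  have cu: "comb u \<noteq> 0" using assms comb_inj by blast
  have au: "a \<times> u \<noteq> 0"
  proof
    assume "a \<times> u = 0"
    moreover have "a \<noteq> 0" using assms by auto
    ultimately obtain k where "k \<noteq> 0" "a = k *\<^sub>R u"
      using cross_eq_0_proportional assms(3) by metis
    then show False using assms by simp
  qed
  have in_span: "\<exists>s t. v = s *\<^sub>R a + t *\<^sub>R u" if "(a \<times> u) \<bullet> v = 0" for v
  proof -
    let ?n = "a \<times> u"
    (* Expanding n x (v x n) in two ways by Lagrange's identity: in terms of v and n, where the n
       term vanishes because v is orthogonal to n, and in terms of a and u. *)
    have "?n \<times> (v \<times> ?n) = (?n \<bullet> ?n) *\<^sub>R v" using that by (simp add: Lagrange[of ?n v ?n])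
    moreover have "?n \<times> (v \<times> ?n) = - ((v \<times> ?n) \<times> ?n)" by (metis cross_skew)
    moreover have "(v \<times> ?n) \<times> ?n = ((v \<times> ?n) \<bullet> u) *\<^sub>R a - ((v \<times> ?n) \<bullet> a) *\<^sub>R u"
      by (rule Lagrange)
    ultimately have "(?n \<bullet> ?n) *\<^sub>R v = (- ((v \<times> ?n) \<bullet> u)) *\<^sub>R a + ((v \<times> ?n) \<bullet> a) *\<^sub>R u"
      by simp
    then have "inverse (?n \<bullet> ?n) *\<^sub>R (?n \<bullet> ?n) *\<^sub>R v =
       inverse (?n \<bullet> ?n) *\<^sub>R ((- ((v \<times> ?n) \<bullet> u)) *\<^sub>R a + ((v \<times> ?n) \<bullet> a) *\<^sub>R u)" by (simp only:)
    moreover have "?n \<bullet> ?n \<noteq> 0" using au by simp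
    ultimately have "v = inverse (?n \<bullet> ?n) *\<^sub>R ((- ((v \<times> ?n) \<bullet> u)) *\<^sub>R a + ((v \<times> ?n) \<bullet> a) *\<^sub>R u)"
      by simp
    then show ?thesis by (simp only: scaleR_add_right scaleR_scaleR) blast
  qed
  have orth: "(a \<times> u) \<bullet> a = 0" "(a \<times> u) \<bullet> u = 0"
    by (simp_all add: dot_cross_self inner_commute)
  have dir: "{x - y |x y. x \<in> ?l \<and> y \<in> ?l} = span {comb u}"
  proof -
    have "(comb a + s *\<^sub>R comb u) - (comb a + t *\<^sub>R comb u) = (s - t) *\<^sub>R comb u" for s t
      by (simp add: algebra_simps)
    moreover have "s *\<^sub>R comb u = (comb a + s *\<^sub>R comb u) - (comb a + 0 *\<^sub>R comb u)" for s
      by simp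
    ultimately show ?thesis unfolding span_singleton by blast
  qed
  have "X \<in> extended_line ?l \<longleftrightarrow> X \<in> line (a \<times> u)" for X
  proof -
    obtain v where v: "v \<noteq> 0" "X = pt v" by (rule pt_surj)
    show ?thesis
    proof
      assume "X \<in> extended_line ?l"
      then consider t where "X = Ordinary (comb a + t *\<^sub>R comb u)"
        | d where "X = Infinite d" "Rep_direction d = span {comb u}"
        unfolding extended_line_def dir by blast
      then show "X \<in> line (a \<times> u)"
      proof cases
        case 1
        then have "X = pt (a + t *\<^sub>R u)" by (simp add: pt_def assms)
        moreover have "weight (a + t *\<^sub>R u) \<noteq> 0" by (simp add: assms)
        then have "a + t *\<^sub>R u \<noteq> 0" by (metis weight_simps(4))
        ultimately show ?thesis by (simp add: pt_in_line_iff orth inner_add_right)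
      next
        case 2
        then have "d = Abs_direction (span {comb u})" by (metis Rep_direction_inverse)
        then have "X = pt u" using 2 by (simp add: pt_def assms)
        then show ?thesis by (simp add: pt_in_line_iff assms orth)
      qed
    next
      assume "X \<in> line (a \<times> u)"
      then obtain s t where st: "v = s *\<^sub>R a + t *\<^sub>R u"
        using in_span pt_in_line_iff v by metis
      show "X \<in> extended_line ?l"
      proof (cases "s = 0")
        case True
        then have "X = pt u" using v st pt_scale[of t u] by auto
        then have "X = Infinite (Abs_direction (span {comb u}))" by (simp add: pt_def assms)
        then show ?thesis unfolding extended_line_def dir using Rep_direction_span[OF cu] by blast
      next
        case False
        then have "X = Ordinary ((s *\<^sub>R comb a + t *\<^sub>R comb u) /\<^sub>R s)"
          using v st by (simp add: pt_def assms)
        then have "X = Ordinary (comb a + (t / s) *\<^sub>R comb u)" using False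
          by (simp add: scaleR_add_right divide_inverse mult.commute)
        then show ?thesis unfolding extended_line_def by blast
      qed
    qed
  qed
  then show ?thesis by blast
qed

text \<open>
  A linear form \<open>a\<close> that is not a multiple of the weight vanishes at one infinite point
  \<open>u = a \<times> (1, 1, 1)\<close> only; the second point \<open>u \<times> a\<close> of its zero set is ordinary, because its
  weight is \<open>u \<bullet> u\<close>.  The two points present the zero set as an extended affine line.
\<close>

lemma is_line_line: assumes "a \<noteq> 0" shows "is_line (line a)"
proof (cases "a \<times> vector [1, 1, 1] = 0")
  case True
  moreover have "(vector [1, 1, 1] :: real^3) \<noteq> 0" by (simp add: vec_eq_iff forall_3)
  ultimately show ?thesis
    unfolding is_line_def line_at_infinity_eq using line_eq assms by blast
next
  case False
  define u where "u = a \<times> vector [1, 1, 1]"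
  have w: "weight v = v \<bullet> vector [1, 1, 1]" for v
    by (simp add: inner_vec_def sum_3 weight_def)
  have u: "u \<noteq> 0" "weight u = 0" "a \<bullet> u = 0"
    using False unfolding w u_def by (simp_all add: dot_cross_self)
  have "weight (u \<times> a) = u \<bullet> u" unfolding w
    by (simp add: cross_triple u_def)
  then have wn: "weight (u \<times> a) \<noteq> 0" using u by simp
  define b where "b = inverse (weight (u \<times> a)) *\<^sub>R (u \<times> a)"
  have b: "weight b = 1" "a \<bullet> b = 0"
    using wn by (simp_all add: b_def dot_cross_self)
  let ?l = "range (\<lambda>t. comb b + t *\<^sub>R comb u)"
  have l: "?l = affine hull {comb b, comb b + comb u}" by (simp add: affine_hull_2_alt)
  have cu: "comb u \<noteq> 0" using u comb_inj by blast
  have "affine ?l" unfolding l by simp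
  moreover have "aff_dim ?l = 1" unfolding l using cu by simp
  moreover have "b \<times> u \<noteq> 0"
  proof
    assume 0: "b \<times> u = 0"
    have "b \<noteq> 0" using b(1) by auto
    then show False using cross_eq_0_proportional[OF 0 _ u(1)] b(1) u(2)
      by (metis mult_zero_right weight_simps(3) zero_neq_one)
  qed
  then have "line a = extended_line ?l"
    unfolding extended_line_eq[OF b(1) u(2) u(1)] using u b assms
    by (intro line_eq orthogonal_both_imp_cross) auto
  ultimately show ?thesis unfolding is_line_def by blast
qed

lemma is_line_cases: assumes "is_line m" obtains a where "a \<noteq> 0" "m = line a"
proof (cases "m = line_at_infinity")
  case True
  moreover have "(vector [1, 1, 1] :: real^3) \<noteq> 0" by (simp add: vec_eq_iff forall_3)
  ultimately show ?thesis using that line_at_infinity_eq by blast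
next
  case False
  then obtain l where l: "affine l" "aff_dim l = 1" "m = extended_line l"
    using assms by (auto simp: is_line_def)
  obtain S where S: "S \<subseteq> l" "\<not> affine_dependent S" "affine hull S = l"
    using affine_basis_exists[of l] l(1) by (metis affine_hull_eq)
  then have "card S = 2" using l(2) aff_dim_unique[of S l] aff_dim_affine_independent
    by (metis aff_dim_affine_hull diff_add_cancel of_nat_eq_iff of_nat_numeral one_add_one diff_eq_eq)
  then obtain x y where "S = {x, y}" "x \<noteq> y" by (meson card_2_iff)
  then have ll: "l = range (\<lambda>t. x + t *\<^sub>R (y - x))" using S by (simp add: affine_hull_2_alt)
  obtain a where a: "weight a = 1" "comb a = x" by (rule comb_surj)
  obtain u where u: "weight u = 0" "comb u = y - x" by (rule comb_surj)
  have "u \<noteq> 0" using u \<open>x \<noteq> y\<close> by auto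
  then have "m = line (a \<times> u)" using extended_line_eq[OF a(1) u(1)] l(3) a u by (simp add: ll)
  moreover have "a \<times> u \<noteq> 0"
  proof
    assume 0: "a \<times> u = 0"
    have "a \<noteq> 0" using a(1) by auto
    then show False using cross_eq_0_proportional[OF 0 _ \<open>u \<noteq> 0\<close>] a(1) u(1)
      by (metis mult_zero_right weight_simps(3) zero_neq_one)
  qed
  ultimately show ?thesis using that by blast
qed

lemma join_pt: assumes "u \<times> v \<noteq> 0" shows "join (pt u) (pt v) = line (u \<times> v)"
proof -
  have nz: "u \<noteq> 0" "v \<noteq> 0" using assms by auto
  show ?thesis unfolding join_def
  proof (rule the_equality)
    show "is_line (line (u \<times> v)) \<and> pt u \<in> line (u \<times> v) \<and> pt v \<in> line (u \<times> v)"
      using assms nz by (simp add: is_line_line pt_in_line_iff dot_cross_self inner_commute)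
  next
    fix l assume l: "is_line l \<and> pt u \<in> l \<and> pt v \<in> l"
    then obtain a where a: "a \<noteq> 0" "l = line a" using is_line_cases by blast
    then have "a \<bullet> u = 0" "a \<bullet> v = 0" using l nz by (simp_all add: pt_in_line_iff)
    then show "l = line (u \<times> v)" unfolding a(2)
      by (intro line_eq orthogonal_both_imp_cross a(1) assms)
  qed
qed

text \<open>
  Two of the lines must be distinct, which is the condition \<open>a \<times> b \<noteq> 0\<close>; they already determine
  the common point, so the remaining lines only have to pass through it.
\<close>

lemma common_point_eqI:
  assumes "v \<noteq> 0" "\<And>l. l \<in> L \<Longrightarrow> pt v \<in> l"
    and "line a \<in> L" "line b \<in> L" "a \<times> b \<noteq> 0"
  shows "common_point L = pt v"
  unfolding common_point_def
proof (rule the_equality)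
  fix X assume X: "\<forall>l\<in>L. X \<in> l"
  obtain w where w: "w \<noteq> 0" "X = pt w" by (rule pt_surj)
  have "a \<bullet> v = 0" "b \<bullet> v = 0" "a \<bullet> w = 0" "b \<bullet> w = 0"
    using assms X w(1) unfolding w(2) by (metis pt_in_line_iff)+
  then have "v \<times> (a \<times> b) = 0" "w \<times> (a \<times> b) = 0"
    by (simp_all add: orthogonal_both_imp_cross inner_commute)
  then obtain k l where "k \<noteq> 0" "v = k *\<^sub>R (a \<times> b)" "l \<noteq> 0" "w = l *\<^sub>R (a \<times> b)"
    using cross_eq_0_proportional[OF _ assms(1,5)] cross_eq_0_proportional[OF _ w(1) assms(5)]
    by metis
  then show "X = pt v" by (simp add: w pt_scale)
qed (use assms in auto)


section \<open>Affine maps in barycentric coordinates\<close>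

lemma inj_if_frame_map:
  assumes "\<And>v. v \<noteq> 0 \<Longrightarrow> T (pt v) = pt (frame_map d\<^sub>1 d\<^sub>2 d\<^sub>3 v)"
    and det: "d\<^sub>1 \<bullet> (d\<^sub>2 \<times> d\<^sub>3) \<noteq> 0"
  shows "inj T"
proof
  fix X Y assume eq: "T X = T Y"
  obtain u where u: "u \<noteq> 0" "X = pt u" by (rule pt_surj)
  obtain v where v: "v \<noteq> 0" "Y = pt v" by (rule pt_surj)
  have "pt (frame_map d\<^sub>1 d\<^sub>2 d\<^sub>3 u) = pt (frame_map d\<^sub>1 d\<^sub>2 d\<^sub>3 v)"
    using assms u v eq by metis
  then obtain k where k: "k \<noteq> 0" "frame_map d\<^sub>1 d\<^sub>2 d\<^sub>3 u = k *\<^sub>R frame_map d\<^sub>1 d\<^sub>2 d\<^sub>3 v"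
    using proportional_if_pt_eq frame_map_eq_0[OF det] u(1) v(1) by metis
  have "frame_map d\<^sub>1 d\<^sub>2 d\<^sub>3 (u - k *\<^sub>R v) =
      frame_map d\<^sub>1 d\<^sub>2 d\<^sub>3 u - k *\<^sub>R frame_map d\<^sub>1 d\<^sub>2 d\<^sub>3 v"
    by (simp add: frame_map_def algebra_simps)
  then have "u = k *\<^sub>R v" using k frame_map_eq_0[OF det, of "u - k *\<^sub>R v"] by simp
  then show "X = Y" using u v k pt_scale by simp
qed

lemma pt_weight_1: "weight v = 1 \<Longrightarrow> pt v = Ordinary (comb v)"
  by (simp add: pt_def)

text \<open>
  Affine maps preserve affine combinations, which is linearity in normalized coordinates.  This
  needs representatives \<open>d\<^sub>i\<close> of weight 1 for the images: then \<open>frame_map\<close> preserves weights and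
  the formula also covers the infinite points.
\<close>

lemma extend_pt:
  assumes g: "linear g" "bij g"
    and w: "weight d\<^sub>1 = 1" "weight d\<^sub>2 = 1" "weight d\<^sub>3 = 1"
    and f: "f = (\<lambda>x. g x + c)" "f A = comb d\<^sub>1" "f B = comb d\<^sub>2" "f C = comb d\<^sub>3"
    and "v \<noteq> 0"
  shows "extend f (pt v) = pt (frame_map d\<^sub>1 d\<^sub>2 d\<^sub>3 v)"
proof -
  interpret linear g by (rule g(1))
  have wf: "weight (frame_map d\<^sub>1 d\<^sub>2 d\<^sub>3 v) = weight v"
    by (simp add: frame_map_def w) (simp add: weight_def)
  have "comb (frame_map d\<^sub>1 d\<^sub>2 d\<^sub>3 v) = v $ 1 *\<^sub>R f A + v $ 2 *\<^sub>R f B + v $ 3 *\<^sub>R f C"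
    by (simp add: frame_map_def f(2-4))
  then have cf: "comb (frame_map d\<^sub>1 d\<^sub>2 d\<^sub>3 v) = g (comb v) + weight v *\<^sub>R c"
    by (simp add: f(1) comb_def weight_def add scale algebra_simps)
  show ?thesis
  proof (cases "weight v = 0")
    case True
    then have "comb v \<noteq> 0" using comb_inj \<open>v \<noteq> 0\<close> by blast
    have "(\<lambda>x. f x - f 0) ` span {comb v} = g ` span {comb v}"
      by (simp add: f(1) zero)
    also have "\<dots> = span {g (comb v)}"
      using linear_span_image[OF g(1), of "{comb v}"] by simp
    finally have "(\<lambda>x. f x - f 0) ` span {comb v} = span {g (comb v)}" .
    then show ?thesis
      using True wf cf by (simp add: pt_def Rep_direction_span[OF \<open>comb v \<noteq> 0\<close>])
  next
    case False
    then show ?thesis using wf cf by (simp add: pt_def f(1) scale scaleR_add_right)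
  qed
qed

text \<open>
  Existence: the images of the independent edge vectors \<open>B - A\<close>, \<open>C - A\<close> can be prescribed, and
  the nonzero determinant makes the resulting map bijective.  Uniqueness: the action on all points
  is given by \<open>frame_map\<close>.
\<close>

lemma affine_map_taking_pt:
  fixes d\<^sub>1 d\<^sub>2 d\<^sub>3 :: "real^3"
  assumes w: "weight d\<^sub>1 = 1" "weight d\<^sub>2 = 1" "weight d\<^sub>3 = 1"
    and det: "d\<^sub>1 \<bullet> (d\<^sub>2 \<times> d\<^sub>3) \<noteq> 0"
    and "v \<noteq> 0"
  shows "affine_map_taking (ordinary_triangle A B C) (pt d\<^sub>1, pt d\<^sub>2, pt d\<^sub>3) (pt v) =
    pt (frame_map d\<^sub>1 d\<^sub>2 d\<^sub>3 v)"
proof -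
  let ?P = "\<lambda>T. is_affine_map T \<and> T (Ordinary A) = pt d\<^sub>1 \<and> T (Ordinary B) = pt d\<^sub>2
    \<and> T (Ordinary C) = pt d\<^sub>3"
  have act: "T (pt u) = pt (frame_map d\<^sub>1 d\<^sub>2 d\<^sub>3 u)" if T: "?P T" and "u \<noteq> 0" for T u
  proof -
    obtain g c where g: "linear g" "bij g" "T = extend (\<lambda>x. g x + c)"
      using T by (auto simp: is_affine_map_def)
    show ?thesis unfolding g(3)
      by (rule extend_pt[OF g(1,2) w refl _ _ _ \<open>u \<noteq> 0\<close>])
        (use T w g(3) in \<open>simp_all add: pt_weight_1\<close>)
  qed
  have ex: "\<exists>T. ?P T"
  proof -
    define h where "h x = (if x = B - A then comb d\<^sub>2 - comb d\<^sub>1 else comb d\<^sub>3 - comb d\<^sub>1)" for x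
    obtain g where g: "linear g" "\<forall>x\<in>{C - A, B - A}. g x = h x"
      using linear_independent_extend[OF edges_independent(1), of h] by blast
    interpret linear g by (rule g(1))
    have gB: "g (B - A) = comb d\<^sub>2 - comb d\<^sub>1" and gC: "g (C - A) = comb d\<^sub>3 - comb d\<^sub>1"
      using g(2) edges_independent(2) by (simp_all add: h_def)
    have "x = 0" if "g x = 0" for x
    proof -
      obtain b c where x: "x = b *\<^sub>R (B - A) + c *\<^sub>R (C - A)" by (rule edge_coordinates)
      let ?u = "frame_map d\<^sub>1 d\<^sub>2 d\<^sub>3 (vector [- b - c, b, c])"
      have "g x = b *\<^sub>R (comb d\<^sub>2 - comb d\<^sub>1) + c *\<^sub>R (comb d\<^sub>3 - comb d\<^sub>1)"
        unfolding x by (simp only: add scale gB gC)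
      then have "comb ?u = 0" using that by (simp add: frame_map_def algebra_simps)
      moreover have "weight ?u = 0" by (simp add: frame_map_def w)
      ultimately have "?u = 0" using comb_inj by blast
      then have "(vector [- b - c, b, c] :: real^3) = 0" using frame_map_eq_0[OF det] by blast
      then have "b = 0 \<and> c = 0" by (simp add: vec_eq_iff forall_3)
      then show ?thesis by (simp add: x)
    qed
    then have "inj g" using inj_iff_eq_0 by blast
    then have "bij g" using linear_inj_imp_surj[OF g(1)] by (simp add: bij_def)
    let ?T = "extend (\<lambda>x. g x + (comb d\<^sub>1 - g A))"
    have "is_affine_map ?T" unfolding is_affine_map_def using g(1) \<open>bij g\<close> by blast
    moreover have "?T (Ordinary A) = pt d\<^sub>1" "?T (Ordinary B) = pt d\<^sub>2" "?T (Ordinary C) = pt d\<^sub>3"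
      using gB gC by (simp_all add: pt_weight_1 w diff algebra_simps)
    ultimately show ?thesis by blast
  qed
  have uniq: "S = T" if "?P S" "?P T" for S T
  proof
    fix X
    obtain u where "u \<noteq> 0" "X = pt u" by (rule pt_surj)
    then show "S X = T X" using act[OF that(1)] act[OF that(2)] by simp
  qed
  from ex obtain T where T: "?P T" ..
  have "?P (THE T. ?P T)" by (rule theI[of ?P, OF T]) (rule uniq[OF _ T])
  from act[OF this \<open>v \<noteq> 0\<close>] show ?thesis by (simp add: ordinary_triangle_def)
qed


section \<open>Cevians, reflections and the complement map in coordinates\<close>

lemma vertices:
  "Ordinary A = pt (vector [1, 0, 0])" "Ordinary B = pt (vector [0, 1, 0])"
  "Ordinary C = pt (vector [0, 0, 1])"
  by (simp_all add: pt_weight_1)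

lemma pt_vector_scale:
  assumes "k \<noteq> 0" "x' = k * x" "y' = k * y" "z' = k * z"
  shows "pt (vector [x', y', z']) = pt (vector [x, y, z])"
proof -
  have "(vector [x', y', z'] :: real^3) = k *\<^sub>R vector [x, y, z]"
    using assms by (simp add: vec_eq_iff forall_3)
  then show ?thesis using pt_scale assms(1) by simp
qed

lemma pt_vector_surj: obtains x y z where "(vector [x, y, z] :: real^3) \<noteq> 0" "X = pt (vector [x, y, z])"
proof -
  obtain v where "v \<noteq> 0" "X = pt v" by (rule pt_surj)
  moreover have "v = vector [v $ 1, v $ 2, v $ 3]" by (simp add: vec_eq_iff forall_3)
  ultimately show ?thesis using that by metis
qed

lemma is_ordinary_pt_iff: "is_ordinary (pt v) \<longleftrightarrow> weight v \<noteq> 0"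
  by (simp add: pt_def)

lemma meet_line:
  assumes "v \<noteq> 0" "a \<bullet> v = 0" "b \<bullet> v = 0" "a \<times> b \<noteq> 0"
  shows "meet (line a) (line b) = pt v"
  unfolding meet_def
  by (rule common_point_eqI[of _ _ a b]) (use assms in \<open>auto simp: pt_in_line_iff\<close>)

lemma on_sides_ordinary_iff:
  "(vector [p, q, r] :: real^3) \<noteq> 0 \<Longrightarrow>
   on_sides (pt (vector [p, q, r])) (ordinary_triangle A B C) \<longleftrightarrow> p = 0 \<or> q = 0 \<or> r = 0"
  by (auto simp: ordinary_triangle_def vertices join_pt vector_3_calc pt_in_line_iff)

lemma cevian_triangle_pt:
  assumes "p \<noteq> 0" "q \<noteq> 0" "r \<noteq> 0"
  shows "cevian_triangle (ordinary_triangle A B C) (pt (vector [p, q, r])) =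
    (pt (vector [0, q, r]), pt (vector [p, 0, r]), pt (vector [p, q, 0]))"
  using assms
  by (auto simp: ordinary_triangle_def vertices join_pt vector_3_calc intro!: meet_line)

text \<open>
  The cevian from \<open>A\<close> through \<open>x : y : z\<close> consists of the points whose last two coordinates
  are proportional to \<open>y\<close>, \<open>z\<close>, so the equations say that each line passes through \<open>x : y : z\<close>.  This locates
  \<open>P'\<close>, \<open>X\<close> and \<open>X'\<close>.
\<close>

lemma common_point_cevians:
  assumes "x \<noteq> 0" "y \<noteq> 0" "z \<noteq> 0"
    and "u\<^sub>2 \<noteq> 0" "u\<^sub>2 * z = u\<^sub>3 * y"
    and "v\<^sub>1 \<noteq> 0" "v\<^sub>1 * z = v\<^sub>3 * x"
    and "w\<^sub>1 \<noteq> 0" "w\<^sub>1 * y = w\<^sub>2 * x"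
  shows "common_point {join (Ordinary A) (pt (vector [u\<^sub>1, u\<^sub>2, u\<^sub>3])),
                       join (Ordinary B) (pt (vector [v\<^sub>1, v\<^sub>2, v\<^sub>3])),
                       join (Ordinary C) (pt (vector [w\<^sub>1, w\<^sub>2, w\<^sub>3]))} = pt (vector [x, y, z])"
proof -
  have nz: "u\<^sub>3 \<noteq> 0" "v\<^sub>3 \<noteq> 0" using assms by auto
  show ?thesis
    by (rule common_point_eqI[of _ _ "vector [0, - u\<^sub>3, u\<^sub>2]" "vector [v\<^sub>3, 0, - v\<^sub>1]"])
      (use assms nz in \<open>auto simp: vertices join_pt vector_3_calc pt_in_line_iff algebra_simps\<close>)
qed

lemma bij_scaleR: "k \<noteq> 0 \<Longrightarrow> bij (\<lambda>x :: 'a :: real_vector. k *\<^sub>R x)"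
  by (rule bij_betw_byWitness[of _ "\<lambda>x. x /\<^sub>R k"]) auto

lemma extend_homothety_pt:
  assumes "k \<noteq> 0" "weight d\<^sub>1 = 1" "weight d\<^sub>2 = 1" "weight d\<^sub>3 = 1" "v \<noteq> 0"
    and "f = (\<lambda>x. k *\<^sub>R x + c)" "f A = comb d\<^sub>1" "f B = comb d\<^sub>2" "f C = comb d\<^sub>3"
  shows "extend f (pt v) = pt (frame_map d\<^sub>1 d\<^sub>2 d\<^sub>3 v)"
  by (rule extend_pt[OF linear_scale_self bij_scaleR]) (use assms in auto)

text \<open>
  The reflection in the midpoint of \<open>BC\<close> exchanges \<open>B\<close> and \<open>C\<close> and sends \<open>A\<close> to
  \<open>B + C - A\<close>, which gives the columns of its matrix.  On \<open>BC\<close>, where \<open>x = 0\<close>, it just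
  exchanges the last two coordinates.
\<close>

lemma point_reflection_pt:
  assumes "(vector [x, y, z] :: real^3) \<noteq> 0"
  shows "point_reflection (midpoint B C) (pt (vector [x, y, z])) = pt (vector [- x, x + z, x + y])"
    and "point_reflection (midpoint A C) (pt (vector [x, y, z])) = pt (vector [y + z, - y, x + y])"
    and "point_reflection (midpoint A B) (pt (vector [x, y, z])) = pt (vector [y + z, x + z, - z])"
proof -
  have f: "(\<lambda>x. 2 *\<^sub>R M - x) = (\<lambda>x. (- 1) *\<^sub>R x + 2 *\<^sub>R M)" for M :: "real^2"
    by (simp add: fun_eq_iff)
  show "point_reflection (midpoint B C) (pt (vector [x, y, z])) = pt (vector [- x, x + z, x + y])"
    unfolding point_reflection_def
    by (subst extend_homothety_pt[where k = "- 1" and c = "2 *\<^sub>R midpoint B C" and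
          d\<^sub>1 = "vector [- 1, 1, 1]" and d\<^sub>2 = "vector [0, 0, 1]" and d\<^sub>3 = "vector [0, 1, 0]"])
      (use assms in \<open>simp_all add: f midpoint_def frame_map_vector_3 algebra_simps\<close>)
  show "point_reflection (midpoint A C) (pt (vector [x, y, z])) = pt (vector [y + z, - y, x + y])"
    unfolding point_reflection_def
    by (subst extend_homothety_pt[where k = "- 1" and c = "2 *\<^sub>R midpoint A C" and
          d\<^sub>1 = "vector [0, 0, 1]" and d\<^sub>2 = "vector [1, - 1, 1]" and d\<^sub>3 = "vector [1, 0, 0]"])
      (use assms in \<open>simp_all add: f midpoint_def frame_map_vector_3 algebra_simps\<close>)
  show "point_reflection (midpoint A B) (pt (vector [x, y, z])) = pt (vector [y + z, x + z, - z])"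
    unfolding point_reflection_def
    by (subst extend_homothety_pt[where k = "- 1" and c = "2 *\<^sub>R midpoint A B" and
          d\<^sub>1 = "vector [0, 1, 0]" and d\<^sub>2 = "vector [1, 0, 0]" and d\<^sub>3 = "vector [1, 1, - 1]"])
      (use assms in \<open>simp_all add: f midpoint_def frame_map_vector_3 algebra_simps\<close>)
qed

text \<open>The complement map sends each vertex to the midpoint of the opposite side.\<close>

lemma complement_map_frame:
  assumes "v \<noteq> 0"
  shows "complement_map A B C (pt v) =
    pt (frame_map (vector [0, 1/2, 1/2]) (vector [1/2, 0, 1/2]) (vector [1/2, 1/2, 0]) v)"
  unfolding complement_map_def
  by (rule extend_homothety_pt[where k = "- (1/2)" and c = "(3/2) *\<^sub>R centroid A B C"])
    (use assms in \<open>simp_all add: fun_eq_iff centroid_def algebra_simps flip: scaleR_add_left\<close>)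

lemma complement_map_pt:
  assumes "(vector [x, y, z] :: real^3) \<noteq> 0"
  shows "complement_map A B C (pt (vector [x, y, z])) = pt (vector [y + z, x + z, x + y])"
  unfolding complement_map_frame[OF assms] frame_map_vector_3
  by (rule pt_vector_scale[of "1/2"]) (auto simp: algebra_simps)

text \<open>Injectivity lets \<open>inv\<close> in the anticomplementary triangle be evaluated by exhibiting preimages.\<close>

lemma inj_complement_map: "inj (complement_map A B C)"
  by (rule inj_if_frame_map[OF complement_map_frame]) (simp_all add: vector_3_calc)

lemma anticomplementary_triangle_pt:
  "anticomplementary_triangle A B C =
   (pt (vector [- 1, 1, 1]), pt (vector [1, - 1, 1]), pt (vector [1, 1, - 1]))"
proof -
  have s: "pt (vector [2, 0, 0]) = Ordinary A" "pt (vector [0, 2, 0]) = Ordinary B"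
    "pt (vector [0, 0, 2]) = Ordinary C"
    unfolding vertices by (rule pt_vector_scale[of 2]; simp)+
  show ?thesis
    unfolding anticomplementary_triangle_def ordinary_triangle_def
    by (simp add: s complement_map_pt vector_3_calc inv_f_eq[OF inj_complement_map])
qed

lemma on_sides_anticomplementary_iff:
  "(vector [p, q, r] :: real^3) \<noteq> 0 \<Longrightarrow>
   on_sides (pt (vector [p, q, r])) (anticomplementary_triangle A B C) \<longleftrightarrow>
     q + r = 0 \<or> p + r = 0 \<or> p + q = 0"
  unfolding anticomplementary_triangle_pt
  by (auto simp: join_pt vector_3_calc pt_in_line_iff)

lemma reflected_cevian_triangle_pt:
  assumes "p \<noteq> 0" "q \<noteq> 0" "r \<noteq> 0"
  shows "reflected_cevian_triangle A B C (pt (vector [p, q, r])) =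
    (pt (vector [0, r, q]), pt (vector [r, 0, p]), pt (vector [q, p, 0]))"
  using assms unfolding reflected_cevian_triangle_def
  by (simp add: cevian_triangle_pt point_reflection_pt vector_3_eq_0_iff)

lemma isotomcomplement_pt:
  assumes "p \<noteq> 0" "q \<noteq> 0" "r \<noteq> 0"
  shows "isotomcomplement A B C (pt (vector [p, q, r])) =
    pt (vector [p * (q + r), q * (p + r), r * (p + q)])"
proof -
  have "isotomic_conjugate A B C (pt (vector [p, q, r])) = pt (vector [q * r, p * r, p * q])"
    unfolding isotomic_conjugate_def reflected_cevian_triangle_pt[OF assms] Let_def prod.case
    by (rule common_point_cevians) (use assms in auto)
  then show ?thesis using assms
    by (simp add: isotomcomplement_def complement_map_pt vector_3_eq_0_iff algebra_simps)
qed

text \<open>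
  Changing the sign of one coordinate of \<open>Q\<close> gives its harmonic conjugates.  Those for the second
  and third coordinate span the line \<open>v z + w y = 0\<close>, which contains \<open>A\<close>, and so does the line
  from \<open>- u : v : w\<close> to \<open>Q\<close>, on which \<open>y : z = v : w\<close>.
\<close>

lemma is_anticevian_triangle_pt:
  assumes "u \<noteq> 0" "v \<noteq> 0" "w \<noteq> 0"
  shows "is_anticevian_triangle (ordinary_triangle A B C) (pt (vector [u, v, w]))
    (pt (vector [- u, v, w]), pt (vector [u, - v, w]), pt (vector [u, v, - w]))"
  unfolding is_anticevian_triangle_def
proof (intro conjI)
  show "is_triangle (pt (vector [- u, v, w]), pt (vector [u, - v, w]), pt (vector [u, v, - w]))"
    unfolding is_triangle.simps
  proof
    assume "\<exists>l. is_line l \<and> pt (vector [- u, v, w]) \<in> l \<and> pt (vector [u, - v, w]) \<in> l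
      \<and> pt (vector [u, v, - w]) \<in> l"
    then obtain l where l: "is_line l" "pt (vector [- u, v, w]) \<in> l" "pt (vector [u, - v, w]) \<in> l"
      "pt (vector [u, v, - w]) \<in> l" by blast
    obtain a where a: "a \<noteq> 0" "l = line a" using is_line_cases[OF l(1)] .
    have inner: "a \<bullet> vector [x, y, z] = a $ 1 * x + a $ 2 * y + a $ 3 * z" for x y z
      by (simp add: inner_vec_def sum_3)
    have "a \<bullet> vector [- u, v, w] = 0" "a \<bullet> vector [u, - v, w] = 0" "a \<bullet> vector [u, v, - w] = 0"
      using l(2-4) assms(1) unfolding a(2) by (simp_all add: pt_in_line_iff vector_3_eq_0_iff)
    from this[unfolded inner mult_minus_right]
    have "a $ 1 * u = 0" "a $ 2 * v = 0" "a $ 3 * w = 0" by linarith+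
    then show False using a(1) assms by (simp add: vec_eq_iff forall_3)
  qed
  show "\<not> on_sides (pt (vector [u, v, w]))
      (pt (vector [- u, v, w]), pt (vector [u, - v, w]), pt (vector [u, v, - w]))"
    using assms by (auto simp: join_pt vector_3_calc pt_in_line_iff)
  show "cevian_triangle (pt (vector [- u, v, w]), pt (vector [u, - v, w]), pt (vector [u, v, - w]))
      (pt (vector [u, v, w])) = ordinary_triangle A B C"
    using assms
    by (auto simp: ordinary_triangle_def vertices join_pt vector_3_calc intro!: meet_line)
qed


section \<open>The affine maps of the two cevian triangles\<close>

text \<open>
  The columns are the coordinates of \<open>D\<close>, \<open>E\<close>, \<open>F\<close> normalized to weight 1, which is possible since
  the sums are nonzero; the determinant is
  \<open>2 p q r / ((q + r) (p + r) (p + q))\<close>.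
\<close>

lemma cevian_affine_map_pt:
  assumes nz: "p \<noteq> 0" "q \<noteq> 0" "r \<noteq> 0" and s: "q + r \<noteq> 0" "p + r \<noteq> 0" "p + q \<noteq> 0"
    and T: "T = affine_map_taking (ordinary_triangle A B C)
      (pt (vector [0, q, r]), pt (vector [p, 0, r]), pt (vector [p, q, 0]))"
  shows "inj T"
    and "\<And>x y z. (vector [x, y, z] :: real^3) \<noteq> 0 \<Longrightarrow> T (pt (vector [x, y, z])) =
      pt (vector [p * (y / (p + r) + z / (p + q)), q * (x / (q + r) + z / (p + q)),
                  r * (x / (q + r) + y / (p + r))])"
proof -
  let ?d\<^sub>1 = "vector [0, q / (q + r), r / (q + r)] :: real^3"
  let ?d\<^sub>2 = "vector [p / (p + r), 0, r / (p + r)] :: real^3"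
  let ?d\<^sub>3 = "vector [p / (p + q), q / (p + q), 0] :: real^3"
  have d: "pt ?d\<^sub>1 = pt (vector [0, q, r])" "pt ?d\<^sub>2 = pt (vector [p, 0, r])"
    "pt ?d\<^sub>3 = pt (vector [p, q, 0])"
    by (rule pt_vector_scale[of "1 / (q + r)"] pt_vector_scale[of "1 / (p + r)"]
        pt_vector_scale[of "1 / (p + q)"]; use s in simp)+
  have det: "?d\<^sub>1 \<bullet> (?d\<^sub>2 \<times> ?d\<^sub>3) = 2 * p * q * r / ((q + r) * (p + r) * (p + q))"
    using s by (simp add: vector_3_calc field_simps)
  have T_pt: "T (pt v) = pt (frame_map ?d\<^sub>1 ?d\<^sub>2 ?d\<^sub>3 v)" if "v \<noteq> 0" for v
    unfolding T d[symmetric] by (rule affine_map_taking_pt)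
      (use that det nz s in \<open>auto simp flip: add_divide_distrib\<close>)
  show "inj T" by (rule inj_if_frame_map[OF T_pt]) (use det nz s in auto)
  show "T (pt (vector [x, y, z])) =
      pt (vector [p * (y / (p + r) + z / (p + q)), q * (x / (q + r) + z / (p + q)),
                  r * (x / (q + r) + y / (p + r))])" if "(vector [x, y, z] :: real^3) \<noteq> 0" for x y z
    unfolding T_pt[OF that] frame_map_vector_3 by (simp add: algebra_simps)
qed

text \<open>
  The points \<open>D\<^sub>3\<close>, \<open>E\<^sub>3\<close>, \<open>F\<^sub>3\<close> are the cevian points of \<open>P' = q r : p r : p q\<close>, so this is the
  previous lemma for \<open>P'\<close>.
\<close>

lemma isotomic_affine_map_pt:
  assumes nz: "p \<noteq> 0" "q \<noteq> 0" "r \<noteq> 0" and s: "q + r \<noteq> 0" "p + r \<noteq> 0" "p + q \<noteq> 0"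
    and T: "T = affine_map_taking (ordinary_triangle A B C)
      (pt (vector [0, r, q]), pt (vector [r, 0, p]), pt (vector [q, p, 0]))"
  shows "inj T"
    and "\<And>x y z. (vector [x, y, z] :: real^3) \<noteq> 0 \<Longrightarrow> T (pt (vector [x, y, z])) =
      pt (vector [r * y / (p + r) + q * z / (p + q), r * x / (q + r) + p * z / (p + q),
                  q * x / (q + r) + p * y / (p + r)])"
proof -
  have e: "p * r + p * q = p * (q + r)" "q * r + p * q = q * (p + r)" "q * r + p * r = r * (p + q)"
    by (simp_all add: algebra_simps)
  have d: "pt (vector [0, r, q]) = pt (vector [0, p * r, p * q])"
    "pt (vector [r, 0, p]) = pt (vector [q * r, 0, p * q])"
    "pt (vector [q, p, 0]) = pt (vector [q * r, p * r, 0])"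
    by (rule pt_vector_scale[of "1 / p"] pt_vector_scale[of "1 / q"] pt_vector_scale[of "1 / r"];
        use nz in simp)+
  note T' = cevian_affine_map_pt[of "q * r" "p * r" "p * q" T, unfolded e]
  show "inj T" by (rule T'(1)) (use nz s T d in auto)
  fix x y z :: real assume v: "(vector [x, y, z] :: real^3) \<noteq> 0"
  have "T (pt (vector [x, y, z])) = pt (vector
     [q * r * (y / (q * (p + r)) + z / (r * (p + q))),
      p * r * (x / (p * (q + r)) + z / (r * (p + q))),
      p * q * (x / (p * (q + r)) + y / (q * (p + r)))])"
    by (rule T'(2)) (use nz s T d v in auto)
  also have "q * r * (y / (q * (p + r)) + z / (r * (p + q))) = r * y / (p + r) + q * z / (p + q)"
    using nz s by (simp add: distrib_left[of "q * r"])
  also have "p * r * (x / (p * (q + r)) + z / (r * (p + q))) = r * x / (q + r) + p * z / (p + q)"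
    using nz s by (simp add: distrib_left[of "p * r"])
  also have "p * q * (x / (p * (q + r)) + y / (q * (p + r))) = q * x / (q + r) + p * y / (p + r)"
    using nz s by (simp add: distrib_left[of "p * q"])
  finally show "T (pt (vector [x, y, z])) =
      pt (vector [r * y / (p + r) + q * z / (p + q), r * x / (q + r) + p * z / (p + q),
                  q * x / (q + r) + p * y / (p + r)])" .
qed

end


section \<open>The common points \<open>X\<close> and \<open>X'\<close>\<close>

theorem corollary3p10:
  fixes A B C :: "real^2"
    and P Q D E F D\<^sub>3 E\<^sub>3 F\<^sub>3 X X' :: epoint
    and T\<^sub>P T\<^sub>P' :: "epoint \<Rightarrow> epoint"
  assumes "\<not> collinear {A, B, C}"
    and "\<not> on_sides P (ordinary_triangle A B C)"
    and "\<not> on_sides P (anticomplementary_triangle A B C)"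
    and "(D, E, F) = cevian_triangle (ordinary_triangle A B C) P"
    and "(D\<^sub>3, E\<^sub>3, F\<^sub>3) = reflected_cevian_triangle A B C P"
    and "Q = isotomcomplement A B C P"
    and "T\<^sub>P = affine_map_taking (ordinary_triangle A B C) (D, E, F)"
    and "T\<^sub>P' = affine_map_taking (ordinary_triangle A B C) (D\<^sub>3, E\<^sub>3, F\<^sub>3)"
    and "X = common_point {join (Ordinary A) (T\<^sub>P D\<^sub>3),
                           join (Ordinary B) (T\<^sub>P E\<^sub>3),
                           join (Ordinary C) (T\<^sub>P F\<^sub>3)}"
    and "X' = common_point {join (Ordinary A) (T\<^sub>P' D),
                            join (Ordinary B) (T\<^sub>P' E),
                            join (Ordinary C) (T\<^sub>P' F)}"
  shows "is_anticevian_triangle (ordinary_triangle A B C) Q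
           (map_triangle (inv T\<^sub>P') (ordinary_triangle A B C))
       \<and> (T\<^sub>P X' = X \<and> T\<^sub>P' X = X')
       \<and> (is_ordinary X \<longleftrightarrow> is_ordinary X')"
proof -
  interpret reference_triangle A B C by standard (rule assms(1))
  obtain p q r where v: "(vector [p, q, r] :: real^3) \<noteq> 0" and P: "P = pt (vector [p, q, r])"
    by (rule pt_vector_surj)
  have nz: "p \<noteq> 0" "q \<noteq> 0" "r \<noteq> 0"
    using assms(2) unfolding P on_sides_ordinary_iff[OF v] by simp_all
  have s: "q + r \<noteq> 0" "p + r \<noteq> 0" "p + q \<noteq> 0"
    using assms(3) unfolding P on_sides_anticomplementary_iff[OF v] by simp_all
  have DEF: "D = pt (vector [0, q, r])" "E = pt (vector [p, 0, r])" "F = pt (vector [p, q, 0])"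
    using assms(4) unfolding P cevian_triangle_pt[OF nz] by simp_all
  have DEF\<^sub>3: "D\<^sub>3 = pt (vector [0, r, q])" "E\<^sub>3 = pt (vector [r, 0, p])" "F\<^sub>3 = pt (vector [q, p, 0])"
    using assms(5) unfolding P reflected_cevian_triangle_pt[OF nz] by simp_all
  have Q: "Q = pt (vector [p * (q + r), q * (p + r), r * (p + q)])"
    using assms(6) unfolding P isotomcomplement_pt[OF nz] .
  note T\<^sub>P = cevian_affine_map_pt[OF nz s assms(7)[unfolded DEF]]
  note T\<^sub>P' = isotomic_affine_map_pt[OF nz s assms(8)[unfolded DEF\<^sub>3]]
  let ?x = "vector [p\<^sup>2 * (q + r), q\<^sup>2 * (p + r), r\<^sup>2 * (p + q)] :: real^3"
  let ?x' = "vector [q * r * (q + r), p * r * (p + r), p * q * (p + q)] :: real^3"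
  have X: "X = pt ?x"
    unfolding assms(9) DEF\<^sub>3 using nz s
    by (simp add: T\<^sub>P vector_3_eq_0_iff)
      (rule common_point_cevians; simp add: power2_eq_square)
  have X': "X' = pt ?x'"
    unfolding assms(10) DEF using nz s
    by (simp add: T\<^sub>P' vector_3_eq_0_iff)
      (rule common_point_cevians; simp)
  (* The scaling factors come from -p(0,r,q) + q(r,0,p) + r(q,p,0) = (2qr,0,0) and its cyclic
     analogues. *)
  have vertex_images:
    "T\<^sub>P' (pt (vector [- (p * (q + r)), q * (p + r), r * (p + q)])) = Ordinary A"
    "T\<^sub>P' (pt (vector [p * (q + r), - (q * (p + r)), r * (p + q)])) = Ordinary B"
    "T\<^sub>P' (pt (vector [p * (q + r), q * (p + r), - (r * (p + q))])) = Ordinary C"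
    using nz s unfolding vertices
    by (simp_all add: T\<^sub>P' vector_3_eq_0_iff)
      (rule pt_vector_scale[of "2 * q * r"] pt_vector_scale[of "2 * p * r"]
        pt_vector_scale[of "2 * p * q"]; simp)+
  have "map_triangle (inv T\<^sub>P') (ordinary_triangle A B C) =
      (pt (vector [- (p * (q + r)), q * (p + r), r * (p + q)]),
       pt (vector [p * (q + r), - (q * (p + r)), r * (p + q)]),
       pt (vector [p * (q + r), q * (p + r), - (r * (p + q))]))"
    by (simp add: ordinary_triangle_def inv_f_eq[OF T\<^sub>P'(1)] vertex_images)
  then have a: "is_anticevian_triangle (ordinary_triangle A B C) Q
      (map_triangle (inv T\<^sub>P') (ordinary_triangle A B C))"
    using is_anticevian_triangle_pt[of "p * (q + r)" "q * (p + r)" "r * (p + q)"] nz s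
    by (simp add: Q)
  have b: "T\<^sub>P X' = X"
    unfolding X X' using nz s
    by (simp add: T\<^sub>P vector_3_eq_0_iff) (simp add: power2_eq_square algebra_simps)
  have b': "T\<^sub>P' X = X'"
    unfolding X X' using nz s
    by (simp add: T\<^sub>P' vector_3_eq_0_iff) (simp add: power2_eq_square algebra_simps)
  have "weight ?x = weight ?x'" by (simp add: power2_eq_square algebra_simps)
  then have "is_ordinary X \<longleftrightarrow> is_ordinary X'" by (simp add: X X' is_ordinary_pt_iff)
  with a b b' show ?thesis by blast
qed

end
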